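(* Let $k$ be a field, $S = k[x_1,\ldots,x_n]$ with $n\ge1$, $I \subset S$ a proper homogeneous ideal, $d=\dim S/I$, and let $0\le i\le \min\{d,n-1\}$. Assume that $c_i(I) < \infty$. Then $c_i(I) = -\infty$ if $F_i = \emptyset$, and $c_i(I) = \max_{a\in F_i}|a|$ if $F_i\neq\emptyset$.
   Context: $\operatorname{in}(I)$ denotes the initial ideal of $I$ with respect to the (degree) reverse lexicographic order with $x_1>\cdots>x_n$. Put $S_i = k[x_1,\ldots,x_{n-i}]$. Let $J_i\subset S_i$ be the ideal obtained from $\operatorname{in}(I)$ by the evaluation $x_{n-i+1}=\cdots=x_n=0$; i.e. $J_i$ is generated by the monomial generators of $\operatorname{in}(I)$ not divisible by any of $x_{n-i+1},\ldots,x_n$. Let $\tilde J_i\subset S_i$ be the ideal of $S_i$ generated by the monomials obtained from those of $J_i$ by setting $x_{n-i}=1$ (so $J_i\subseteq\tilde J_i$). Define $c_i(I) := \sup\{r \mid (\tilde J_i/J_i)_r \neq 0\}$, with $c_i(I)=-\infty$ if $\tilde J_i=J_i$ (the value $\infty$ is allowed). Let $\mathcal B$ be the finite set of monomials minimally generating $\operatorname{in}(I)$, and $E_i := \{v\in\mathbb N^{n-i} \mid x^v\in\mathcal B\}$, where $x^v = x_1^{\varepsilon_1}\cdots x_s^{\varepsilon_s}$ for $v=(\varepsilon_1,\ldots,\varepsilon_s)$; here $0\in\mathbb N$. For vectors, $a\ge b$ means coordinatewise inequality. $F_i$ is the set of all vectors of the form $a=\max(v_1,\ldots,v_{n-i})-(1,\ldots,1)$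 such that $a\not\ge v$ for every $v\in E_i$, where $v_1,\ldots,v_{n-i}$ is a family of elements of $E_i$ such that for each $j=1,\ldots,n-i$ the $j$th coordinate of $v_j$ is greater than the $j$th coordinate of $v_h$ for all $h\ne j$, and $\max$ is the coordinatewise maximum. For $a=(\alpha_1,\ldots,\alpha_{n-i})$, $|a| := \alpha_1+\cdots+\alpha_{n-i}$. *)

theory Defs
  imports
    "HOL-Algebra.QuotRing"
    "HOL-Library.Poly_Mapping"
    "HOL-Library.Extended_Nat"
    "HOL-Library.Extended_Real"
begin

text \<open>
  Exponent vectors are finitely supported functions \<open>nat \<Rightarrow>\<^sub>0 nat\<close> and polynomials are finitely
  supported functions from exponent vectors to the coefficient field. Variables are counted from
  \<open>0\<close>: the variable written $x_j$ in the literature has index \<open>j - 1\<close>. Thus $k[x_1,\ldots,x_m]$ is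
  \<open>mpoly_ring m\<close>, the subring of polynomials in the variables with index less than \<open>m\<close>.
\<close>

type_synonym expo = "nat \<Rightarrow>\<^sub>0 nat"
type_synonym 'k mpoly = "expo \<Rightarrow>\<^sub>0 'k"

abbreviation "keys \<equiv> Poly_Mapping.keys"
abbreviation "lookup \<equiv> Poly_Mapping.lookup"

definition deg :: "expo \<Rightarrow> nat" where
  "deg u = (\<Sum>j\<in>keys u. lookup u j)"

definition expos :: "nat \<Rightarrow> expo set" where
  "expos m = {u. keys u \<subseteq> {..<m}}"

definition xpow :: "expo \<Rightarrow> 'k::field mpoly" where
  "xpow u = Poly_Mapping.single u 1"

definition var :: "nat \<Rightarrow> 'k::field mpoly" where
  "var j = xpow (Poly_Mapping.single j 1)"

definition monomials :: "nat \<Rightarrow> 'k::field mpoly set" where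
  "monomials m = xpow ` expos m"

definition mpoly_ring :: "nat \<Rightarrow> 'k::field mpoly ring" where
  "mpoly_ring m =
    \<lparr>carrier = {f. keys f \<subseteq> expos m}, monoid.mult = (*), one = 1, zero = 0, add = (+)\<rparr>"

definition homogeneous :: "nat \<Rightarrow> 'k::field mpoly \<Rightarrow> bool" where
  "homogeneous r f \<longleftrightarrow> (\<forall>u\<in>keys f. deg u = r)"

definition homogeneous_ideal :: "nat \<Rightarrow> 'k::field mpoly set \<Rightarrow> bool" where
  "homogeneous_ideal m I \<longleftrightarrow> ideal I (mpoly_ring m) \<and>
    (\<exists>G \<subseteq> carrier (mpoly_ring m). (\<forall>g\<in>G. \<exists>r. homogeneous r g) \<and> I = Idl\<^bsub>mpoly_ring m\<^esub> G)"

text \<open>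
  Krull dimension: the supremum of the lengths of strictly increasing chains of prime ideals.
  With values in \<^typ>\<open>enat\<close> this is the usual notion for nonzero rings only.
\<close>

definition krull_dim :: "('a, 'b) ring_scheme \<Rightarrow> enat" where
  "krull_dim R = Sup {enat l | l. \<exists>P :: nat \<Rightarrow> 'a set.
     (\<forall>j\<le>l. primeideal (P j) R) \<and> (\<forall>j<l. P j \<subset> P (Suc j))}"

text \<open>
  Degree reverse lexicographic order with $x_1 > x_2 > \cdots$: for equal degrees, the vector with
  the larger entry at the last place of disagreement is the smaller one.
\<close>

definition drl_less :: "expo \<Rightarrow> expo \<Rightarrow> bool" where
  "drl_less u v \<longleftrightarrow> deg u < deg v \<or>
     (deg u = deg v \<and> (\<exists>j. lookup v j < lookup u j \<and> (\<forall>l>j. lookup u l = lookup v l)))"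

definition is_leading_expo :: "'k::field mpoly \<Rightarrow> expo \<Rightarrow> bool" where
  "is_leading_expo f u \<longleftrightarrow> u \<in> keys f \<and> (\<forall>w\<in>keys f. w \<noteq> u \<longrightarrow> drl_less w u)"

definition initial_ideal :: "nat \<Rightarrow> 'k::field mpoly set \<Rightarrow> 'k mpoly set" where
  "initial_ideal n I = Idl\<^bsub>mpoly_ring n\<^esub> {xpow u | u. \<exists>f\<in>I. is_leading_expo f u}"

definition evaluate :: "(nat \<Rightarrow> 'k::field mpoly) \<Rightarrow> 'k mpoly \<Rightarrow> 'k mpoly" where
  "evaluate \<sigma> f =
    (\<Sum>u\<in>keys f. Poly_Mapping.single 0 (lookup f u) * (\<Prod>j\<in>keys u. \<sigma> j ^ lookup u j))"

text \<open>
  \<open>J_ideal n i I\<close> and \<open>Jt_ideal n i I\<close> are $J_i$ and $\tilde J_i$, ideals of \<open>mpoly_ring (n - i)\<close>;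
  the variable $x_{n-i}$ has index \<open>n - i - 1\<close>.
\<close>

definition J_ideal :: "nat \<Rightarrow> nat \<Rightarrow> 'k::field mpoly set \<Rightarrow> 'k mpoly set" where
  "J_ideal n i I = evaluate (\<lambda>j. if j < n - i then var j else 0) ` initial_ideal n I"

definition Jt_ideal :: "nat \<Rightarrow> nat \<Rightarrow> 'k::field mpoly set \<Rightarrow> 'k mpoly set" where
  "Jt_ideal n i I = Idl\<^bsub>mpoly_ring (n - i)\<^esub>
     (evaluate (\<lambda>j. if j = n - i - 1 then 1 else var j) ` (monomials (n - i) \<inter> J_ideal n i I))"

text \<open>
  The degree \<open>r\<close> component of \<open>M / N\<close> for homogeneous ideals \<open>N \<subseteq> M\<close> of \<open>mpoly_ring m\<close>: the
  cosets of \<open>N\<close> represented by homogeneous elements of \<open>M\<close> of degree \<open>r\<close>. It is zero iff it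
  consists of the zero coset \<open>N\<close> only.
\<close>

definition quot_component ::
  "nat \<Rightarrow> 'k::field mpoly set \<Rightarrow> 'k mpoly set \<Rightarrow> nat \<Rightarrow> 'k mpoly set set" where
  "quot_component m M N r = {N +>\<^bsub>mpoly_ring m\<^esub> f | f. f \<in> M \<and> homogeneous r f}"

text \<open>In \<^typ>\<open>ereal\<close> the supremum of the empty set is \<open>-\<infinity>\<close>.\<close>

definition c_inv :: "nat \<Rightarrow> nat \<Rightarrow> 'k::field mpoly set \<Rightarrow> ereal" where
  "c_inv n i I = Sup {ereal (real r) | r.
     quot_component (n - i) (Jt_ideal n i I) (J_ideal n i I) r \<noteq> {J_ideal n i I}}"

text \<open>
  A minimal generating set of monomials of a monomial ideal is unique, see
  \<open>ex1_min_monomial_gens\<close> below.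
\<close>

definition is_min_monomial_gens :: "nat \<Rightarrow> 'k::field mpoly set \<Rightarrow> 'k mpoly set \<Rightarrow> bool" where
  "is_min_monomial_gens m J B \<longleftrightarrow> B \<subseteq> monomials m \<and> Idl\<^bsub>mpoly_ring m\<^esub> B = J \<and>
     (\<forall>B'. B' \<subset> B \<longrightarrow> Idl\<^bsub>mpoly_ring m\<^esub> B' \<noteq> J)"

definition min_monomial_gens :: "nat \<Rightarrow> 'k::field mpoly set \<Rightarrow> 'k mpoly set" where
  "min_monomial_gens m J = (THE B. is_min_monomial_gens m J B)"

text \<open>Well-definedness: \<open>mpoly_ring m\<close> is a commutative ring, and \<open>min_monomial_gens\<close> exists.\<close>

lemma expos_add: "u \<in> expos m \<Longrightarrow> v \<in> expos m \<Longrightarrow> u + v \<in> expos m"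
  using Poly_Mapping.keys_add[of u v] by (auto simp: expos_def)

lemma cring_mpoly_ring: "cring (mpoly_ring m :: 'k::field mpoly ring)"
proof (rule cringI)
  show "abelian_group (mpoly_ring m :: 'k mpoly ring)"
  proof (rule abelian_groupI)
    fix x :: "'k mpoly" assume "x \<in> carrier (mpoly_ring m)"
    then show "\<exists>y\<in>carrier (mpoly_ring m). y \<oplus>\<^bsub>mpoly_ring m\<^esub> x = \<zero>\<^bsub>mpoly_ring m\<^esub>"
      by (intro bexI[of _ "- x"]) (auto simp: mpoly_ring_def)
  next
    fix x y :: "'k mpoly" assume "x \<in> carrier (mpoly_ring m)" "y \<in> carrier (mpoly_ring m)"
    then show "x \<oplus>\<^bsub>mpoly_ring m\<^esub> y \<in> carrier (mpoly_ring m)"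
      using Poly_Mapping.keys_add[of x y] by (auto simp: mpoly_ring_def)
  qed (auto simp: mpoly_ring_def ac_simps)
  show "comm_monoid (mpoly_ring m :: 'k mpoly ring)"
  proof (rule comm_monoidI)
    fix x y :: "'k mpoly" assume "x \<in> carrier (mpoly_ring m)" "y \<in> carrier (mpoly_ring m)"
    then show "x \<otimes>\<^bsub>mpoly_ring m\<^esub> y \<in> carrier (mpoly_ring m)"
      using Poly_Mapping.keys_mult[of x y] expos_add by (fastforce simp: mpoly_ring_def)
  qed (auto simp: mpoly_ring_def expos_def ac_simps)
qed (auto simp: mpoly_ring_def algebra_simps)

lemma Idl_monomials:
  assumes A: "A \<subseteq> expos m"
  shows "Idl\<^bsub>mpoly_ring m\<^esub> (xpow ` A) =
    {f :: 'k::field mpoly. keys f \<subseteq> expos m \<and> (\<forall>u\<in>keys f. \<exists>a\<in>A. \<exists>w. u = a + w)}"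
    (is "Idl\<^bsub>?R\<^esub> ?X = ?I")
proof
  interpret R: cring "mpoly_ring m :: 'k mpoly ring" by (rule cring_mpoly_ring)
  have X: "?X \<subseteq> carrier ?R" using A by (auto simp: mpoly_ring_def xpow_def)
  have mul: "r * f \<in> ?I" if f: "f \<in> ?I" and r: "keys r \<subseteq> expos m" for f r :: "'k mpoly"
  proof -
    have "u \<in> expos m \<and> (\<exists>a\<in>A. \<exists>w. u = a + w)" if u: "u \<in> keys (r * f)" for u
    proof -
      obtain p q where pq: "u = p + q" "p \<in> keys r" "q \<in> keys f"
        using Poly_Mapping.keys_mult[of r f] u by blast
      then obtain a w where "a \<in> A" "q = a + w" using f by blast
      then have "u = a + (p + w)" using pq by (simp add: ac_simps)
      with pq f r \<open>a \<in> A\<close> expos_add show ?thesis by blast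
    qed
    then show ?thesis by blast
  qed
  have "ideal ?I ?R"
  proof (rule idealI)
    show "subgroup ?I (add_monoid ?R)"
    proof
      fix x y :: "'k mpoly" assume xy: "x \<in> ?I" "y \<in> ?I"
      then have "x + y \<in> ?I"
        using Poly_Mapping.keys_add[of x y] by blast
      then show "x \<otimes>\<^bsub>add_monoid ?R\<^esub> y \<in> ?I" by (simp add: mpoly_ring_def)
      have x: "x \<in> carrier ?R" using xy by (simp add: mpoly_ring_def)
      have "inv\<^bsub>add_monoid ?R\<^esub> x = - x"
        by (rule R.minus_equality[unfolded a_inv_def]) (use x in \<open>auto simp: mpoly_ring_def\<close>)
      then show "inv\<^bsub>add_monoid ?R\<^esub> x \<in> ?I" using xy by simp
    qed (auto simp: mpoly_ring_def)
  qed (use mul R.ring_axioms in \<open>auto simp: mpoly_ring_def mult.commute\<close>)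
  moreover have "?X \<subseteq> ?I"
  proof -
    have "\<exists>b\<in>A. \<exists>w. a = b + w" if "a \<in> A" for a
      using that by (intro bexI[of _ a] exI[of _ 0]) auto
    then show ?thesis using A by (auto simp: xpow_def)
  qed
  ultimately show "Idl\<^bsub>?R\<^esub> ?X \<subseteq> ?I" by (rule R.genideal_minimal)
  interpret J: ideal "Idl\<^bsub>?R\<^esub> ?X" ?R by (rule R.genideal_ideal[OF X])
  show "?I \<subseteq> Idl\<^bsub>?R\<^esub> ?X"
  proof
    fix f :: "'k mpoly" assume f: "f \<in> ?I"
    have single: "Poly_Mapping.single u (lookup f u) \<in> Idl\<^bsub>?R\<^esub> ?X" if u: "u \<in> keys f" for u
    proof -
      obtain a w where a: "a \<in> A" "u = a + w" using f u by blast
      have "keys w \<subseteq> keys u" using a(2) by (auto simp: in_keys_iff lookup_add)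
      then have "Poly_Mapping.single w (lookup f u) \<in> carrier ?R"
        using f u by (auto simp: mpoly_ring_def expos_def)
      moreover have "xpow a \<in> Idl\<^bsub>?R\<^esub> ?X" using R.genideal_self[OF X] a(1) by blast
      ultimately have "Poly_Mapping.single w (lookup f u) * xpow a \<in> Idl\<^bsub>?R\<^esub> ?X"
        using J.I_l_closed by (fastforce simp: mpoly_ring_def)
      then show ?thesis using a(2) by (simp add: xpow_def Poly_Mapping.mult_single add.commute)
    qed
    have sums: "(\<Sum>u\<in>U. Poly_Mapping.single u (lookup f u)) \<in> Idl\<^bsub>?R\<^esub> ?X" if "finite U" "U \<subseteq> keys f" for U
      using that
    proof (induction U)
      case empty
      show ?case using additive_subgroup.zero_closed[OF J.is_additive_subgroup]
        by (simp add: mpoly_ring_def)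
    next
      case (insert u U)
      then show ?case
        using additive_subgroup.a_closed[OF J.is_additive_subgroup] single[of u]
        by (fastforce simp: mpoly_ring_def)
    qed
    then show "f \<in> Idl\<^bsub>?R\<^esub> ?X"
    proof -
      have "f = (\<Sum>u\<in>keys f. Poly_Mapping.single u (lookup f u))"
        by (rule poly_mapping_eqI)
          (auto simp: lookup_sum lookup_single when_def in_keys_iff)
      moreover have "(\<Sum>u\<in>keys f. Poly_Mapping.single u (lookup f u)) \<in> Idl\<^bsub>?R\<^esub> ?X"
        by (rule sums) auto
      ultimately show ?thesis by simp
    qed
  qed
qed

lemma is_min_monomial_gens_iff:
  fixes B :: "'k::field mpoly set"
  assumes A: "A \<subseteq> expos m"
  defines "J \<equiv> Idl\<^bsub>mpoly_ring m\<^esub> (xpow ` A) :: 'k mpoly set"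
  shows "is_min_monomial_gens m J B \<longleftrightarrow>
    B = xpow ` {u. xpow u \<in> J \<and> (\<forall>w z. u = w + z \<and> xpow w \<in> J \<longrightarrow> w = u)}"
    (is "_ \<longleftrightarrow> B = xpow ` ?M")
proof -
  let ?D = "\<lambda>C. {f :: 'k mpoly. keys f \<subseteq> expos m \<and> (\<forall>u\<in>keys f. \<exists>a\<in>C. \<exists>w. u = a + w)}"
  have J: "J = ?D A" unfolding J_def by (rule Idl_monomials[OF A])
  have xJ: "xpow u \<in> J \<longleftrightarrow> u \<in> expos m \<and> (\<exists>a\<in>A. \<exists>w. u = a + w)" for u
    by (simp add: J xpow_def)
  have Mx: "?M \<subseteq> expos m" using xJ by auto
  have below: "\<exists>a\<in>?M. \<exists>w. u = a + w" if "xpow u \<in> J" for u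
    using that
  proof (induction "deg u" arbitrary: u rule: less_induct)
    case less
    show ?case
    proof (cases "u \<in> ?M")
      case True
      then show ?thesis
        by (intro bexI[of _ u] exI[of _ 0]) auto
    next
      case False
      then obtain w z where w: "u = w + z" "xpow w \<in> J" "w \<noteq> u" using less.prems by blast
      have fin: "finite (keys w \<union> keys z)" by simp
      have s: "deg x = (\<Sum>j\<in>keys w \<union> keys z. lookup x j)" if "keys x \<subseteq> keys w \<union> keys z" for x
        unfolding deg_def
        by (rule sum.mono_neutral_left) (use that in \<open>auto simp: in_keys_iff\<close>)
      have "deg u = deg w + deg z"
        using s[of u] s[of w] s[of z] Poly_Mapping.keys_add[of w z] w(1)
        by (simp add: lookup_add sum.distrib)
      moreover have "keys z \<noteq> {}" using w by auto
      then have "deg z > 0" unfolding deg_def by (intro sum_pos) (auto simp: in_keys_iff)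
      ultimately obtain a y where "a \<in> ?M" "w = a + y" using less.hyps[of w] w(2) by auto
      then show ?thesis using w(1) by (intro bexI[of _ a] exI[of _ "y + z"]) (auto simp: ac_simps)
    qed
  qed
  have genM: "Idl\<^bsub>mpoly_ring m\<^esub> (xpow ` ?M) = J"
  proof -
    have "?D ?M = J"
    proof (intro equalityI subsetI)
      fix f assume f: "f \<in> ?D ?M"
      have "\<exists>a\<in>A. \<exists>w. u = a + w" if "u \<in> keys f" for u
      proof -
        from f that obtain a w where "u = a + w" "a \<in> ?M" by blast
        moreover from this obtain b y where "b \<in> A" "a = b + y" using xJ by blast
        ultimately have "u = b + (y + w)" by (simp add: ac_simps)
        then show ?thesis using \<open>b \<in> A\<close> by blast
      qed
      with f show "f \<in> J" unfolding J by simp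
    next
      fix f assume f: "f \<in> J"
      have fe: "keys f \<subseteq> expos m" and fa: "\<forall>u\<in>keys f. \<exists>a\<in>A. \<exists>w. u = a + w"
        using f unfolding J by auto
      have "\<exists>a\<in>?M. \<exists>w. u = a + w" if "u \<in> keys f" for u
      proof (rule below)
        show "xpow u \<in> J" unfolding xJ using that fe fa by auto
      qed
      with fe show "f \<in> ?D ?M" by simp
    qed
    with Idl_monomials[OF Mx] show ?thesis by (rule trans)
  qed
  have sub: "xpow ` ?M \<subseteq> C" if C: "C \<subseteq> monomials m" "Idl\<^bsub>mpoly_ring m\<^esub> C = J" for C
  proof -
    obtain A' where A': "C = xpow ` A'" "A' \<subseteq> expos m"
      using C(1) unfolding monomials_def by (meson subset_imageE)
    have J': "J = ?D A'"
      using C(2)[symmetric, unfolded A'(1)] Idl_monomials[OF A'(2)] by (rule trans)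
    have "u \<in> A'" if u: "u \<in> ?M" for u
    proof -
      from u have "xpow u \<in> J" by simp
      then have "xpow u \<in> ?D A'" using J' by simp
      then obtain a w where a: "a \<in> A'" "u = a + w" by (auto simp: xpow_def)
      have "\<exists>b\<in>A'. \<exists>w. a = b + w"
        using a(1) by (intro bexI[of _ a] exI[of _ 0]) auto
      then have "xpow a \<in> ?D A'" using a A'(2) by (auto simp: xpow_def)
      then have "xpow a \<in> J" using J' by simp
      with u a(2) have "a = u" by blast
      with a(1) show "u \<in> A'" by simp
    qed
    then have "?M \<subseteq> A'" by (rule subsetI)
    then show ?thesis unfolding A'(1) by (rule image_mono)
  qed
  have monM: "xpow ` ?M \<subseteq> monomials m" unfolding monomials_def by (rule image_mono[OF Mx])
  show ?thesis
  proof (rule iffI)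
    assume "is_min_monomial_gens m J B"
    note * = this[unfolded is_min_monomial_gens_def]
    note B = *[THEN conjunct1] *[THEN conjunct2, THEN conjunct1]
    note min = *[THEN conjunct2, THEN conjunct2, THEN spec, THEN mp]
    show "B = xpow ` ?M"
    proof (rule ccontr)
      assume "B \<noteq> xpow ` ?M"
      from psubsetI[OF sub[OF B] this[symmetric]] have "xpow ` ?M \<subset> B" .
      from min[OF this] genM show False by (rule notE)
    qed
  next
    assume B: "B = xpow ` ?M"
    have "Idl\<^bsub>mpoly_ring m\<^esub> B' \<noteq> J" if B': "B' \<subset> xpow ` ?M" for B'
    proof
      assume J': "Idl\<^bsub>mpoly_ring m\<^esub> B' = J"
      from B' have "B' \<subseteq> xpow ` ?M" by (rule psubset_imp_subset)
      then have "B' \<subseteq> monomials m" using monM by (rule subset_trans)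
      from sub[OF this J'] B' show False by (rule leD[THEN notE])
    qed
    then show "is_min_monomial_gens m J B"
      unfolding is_min_monomial_gens_def B
      by (intro conjI allI impI monM genM)
  qed
qed

lemma ex1_min_monomial_gens:
  assumes "A \<subseteq> expos m"
  shows "\<exists>!B :: 'k::field mpoly set.
    is_min_monomial_gens m (Idl\<^bsub>mpoly_ring m\<^esub> (xpow ` A)) B"
  unfolding is_min_monomial_gens_iff[OF assms] by simp

definition E_set :: "nat \<Rightarrow> nat \<Rightarrow> 'k::field mpoly set \<Rightarrow> expo set" where
  "E_set n i I = {v \<in> expos (n - i). xpow v \<in> min_monomial_gens n (initial_ideal n I)}"

text \<open>
  The vectors in $F_i$ have integer entries, so that subtracting $(1,\ldots,1)$ is not truncated;
  they are functions on \<^typ>\<open>nat\<close> that vanish outside the coordinates \<open>0, \<dots>, m - 1\<close>,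
  where \<open>m = n - i\<close>.
\<close>

definition F_of :: "nat \<Rightarrow> expo set \<Rightarrow> (nat \<Rightarrow> int) set" where
  "F_of m E = {a. (\<exists>v :: nat \<Rightarrow> expo.
      (\<forall>j<m. v j \<in> E) \<and>
      (\<forall>j<m. \<forall>h<m. h \<noteq> j \<longrightarrow> lookup (v h) j < lookup (v j) j) \<and>
      a = (\<lambda>j. if j < m then int (Max ((\<lambda>h. lookup (v h) j) ` {..<m})) - 1 else 0)) \<and>
      (\<forall>v\<in>E. \<not> (\<forall>j<m. int (lookup v j) \<le> a j))}"

definition F_set :: "nat \<Rightarrow> nat \<Rightarrow> 'k::field mpoly set \<Rightarrow> (nat \<Rightarrow> int) set" where
  "F_set n i I = F_of (n - i) (E_set n i I)"

definition vec_sum :: "nat \<Rightarrow> (nat \<Rightarrow> int) \<Rightarrow> int" where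
  "vec_sum m a = (\<Sum>j<m. a j)"

end

theory Submission
  imports Defs
begin

text \<open>
  Both $J_i$ and $\tilde J_i$ are spanned by monomials, so $c_i(I)$ is the supremum of the degrees
  of the exponents lying in $\tilde J_i$ but not in $J_i$. If these degrees are bounded and some
  such exponent exists, then one of maximal degree, say $a$, satisfies $a + e_j \in J_i$ for every
  $j$; generators $v_j \le a + e_j$ then form a family witnessing $a \in F_i$. Conversely every
  $a \in F_i$ is such an exponent, because
  $a + e_{n-i} \ge v_{n-i}$ puts it into $\tilde J_i$.
\<close>

section \<open>Monomial ideals as spans of up-closed sets of exponents\<close>

definition upset :: "expo set \<Rightarrow> expo set" where
  "upset A = {u. \<exists>a\<in>A. \<exists>w. u = a + w}"

definition monomial_span :: "expo set \<Rightarrow> 'k::field mpoly set" where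
  "monomial_span U = {f. keys f \<subseteq> U}"

text \<open>For \<open>E = E_set n i I\<close> and \<open>m = n - i\<close> these are the exponents
  of the monomials in \<open>Jt_ideal\<close> outside \<open>J_ideal\<close>. Setting the last
  variable to 1 in a monomial ideal amounts to saturating by that variable, which is what the
  existential over \<open>k\<close> expresses.\<close>

definition gap :: "nat \<Rightarrow> expo set \<Rightarrow> expo set" where
  "gap m E = {u \<in> expos m. (\<exists>k. u + Poly_Mapping.single (m - 1) k \<in> upset E) \<and> u \<notin> upset E}"

lemma expo_le_iff: "(\<exists>w. u = a + w) \<longleftrightarrow> (\<forall>j. lookup a j \<le> lookup u j)" for u a :: expo
proof
  assume "\<forall>j. lookup a j \<le> lookup u j"
  \<comment> \<open>Subtraction of exponents is truncated coordinatewise; the assumed inequality is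
    what lets \<open>a\<close> be added back.\<close>
  then have "u = a + (u - a)"
    by (intro poly_mapping_eqI) (simp add: lookup_add lookup_minus)
  then show "\<exists>w. u = a + w" ..
qed (auto simp: lookup_add)

lemma in_upset_iff: "u \<in> upset A \<longleftrightarrow> (\<exists>a\<in>A. \<forall>j. lookup a j \<le> lookup u j)"
  unfolding upset_def by (simp add: expo_le_iff)

lemma upset_mono: "u \<in> upset A \<Longrightarrow> (\<And>j. lookup u j \<le> lookup w j) \<Longrightarrow> w \<in> upset A"
  unfolding in_upset_iff by (meson order_trans)

lemma upset_add: "u \<in> upset A \<Longrightarrow> u + w \<in> upset A"
  by (erule upset_mono) (simp add: lookup_add)

lemma in_expos_iff: "u \<in> expos m \<longleftrightarrow> (\<forall>j\<ge>m. lookup u j = 0)"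
proof -
  have "u \<in> expos m \<longleftrightarrow> (\<forall>j. j \<in> keys u \<longrightarrow> j < m)"
    by (auto simp: expos_def)
  then show ?thesis
    by (metis in_keys_iff leD leI)
qed

lemma deg_eq_sum: "u \<in> expos m \<Longrightarrow> deg u = (\<Sum>j<m. lookup u j)"
  unfolding deg_def expos_def
  by (rule sum.mono_neutral_left) (auto simp: in_keys_iff)

text \<open>A monomial ideal is determined by the exponents it contains. The intersection is needed
  because \<open>upset\<close> is formed in infinitely many variables.\<close>

lemma Idl_eq_monomial_span:
  "A \<subseteq> expos m \<Longrightarrow> Idl\<^bsub>mpoly_ring m\<^esub> (xpow ` A) = monomial_span (expos m \<inter> upset A)"
  by (subst Idl_monomials) (auto simp: monomial_span_def upset_def)

lemma xpow_in_span [simp]: "(xpow u :: 'k::field mpoly) \<in> monomial_span U \<longleftrightarrow> u \<in> U"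
  by (simp add: xpow_def monomial_span_def)

lemma xpow_inject [simp]: "(xpow u :: 'k::field mpoly) = xpow v \<longleftrightarrow> u = v"
  by (auto simp: xpow_def dest: arg_cong[where f = keys])

section \<open>The two substitutions, 0 for the trailing variables and 1 for the last one\<close>

lemma xpow_prod: "(\<Prod>j\<in>A. var j ^ e j) = (xpow (\<Sum>j\<in>A. Poly_Mapping.single j (e j)) :: 'k::field mpoly)"
proof -
  have pow: "var j ^ k = (xpow (Poly_Mapping.single j k) :: 'k mpoly)" for j k
    by (induction k) (simp_all add: var_def xpow_def Poly_Mapping.mult_single flip: Poly_Mapping.single_add)
  show ?thesis
    \<comment> \<open>For infinite \<open>A\<close> both sides are 1, the product by its default
      value and the sum because it defaults to the zero exponent.\<close>
    by (induction A rule: infinite_finite_induct)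
      (simp_all add: pow, simp_all add: xpow_def Poly_Mapping.mult_single)
qed

lemma sum_single_lookup: "(\<Sum>j\<in>keys u. Poly_Mapping.single j (lookup u j)) = u"
  by (rule poly_mapping_eqI) (auto simp: lookup_sum lookup_single when_def in_keys_iff)

text \<open>A term with a variable of index at least \<open>m\<close> acquires a factor 0 raised to
  a positive power and vanishes; every other term is left unchanged.\<close>

lemma evaluate_truncate:
  fixes f :: "'k::field mpoly"
  shows "evaluate (\<lambda>j. if j < m then var j else 0) f =
    (\<Sum>u\<in>keys f \<inter> expos m. Poly_Mapping.single u (lookup f u))"
proof -
  have "Poly_Mapping.single 0 (lookup f u) *
      (\<Prod>j\<in>keys u. (if j < m then var j else 0) ^ lookup u j) =
      (if u \<in> expos m then Poly_Mapping.single u (lookup f u) else 0)" for u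
  proof (cases "u \<in> expos m")
    case True
    then have "(\<Prod>j\<in>keys u. (if j < m then var j else 0) ^ lookup u j) =
        (\<Prod>j\<in>keys u. var j ^ lookup u j :: 'k mpoly)"
      by (intro prod.cong) (auto simp: expos_def)
    also have "\<dots> = xpow u" by (simp add: xpow_prod sum_single_lookup)
    finally show ?thesis using True by (simp add: xpow_def Poly_Mapping.mult_single)
  next
    case False
    then obtain j where "j \<in> keys u" "\<not> j < m" by (auto simp: expos_def)
    then have "(\<Prod>j\<in>keys u. (if j < m then var j else 0 :: 'k mpoly) ^ lookup u j) = 0"
      by (intro prod_zero) (auto intro!: bexI[of _ j] simp: in_keys_iff)
    with False show ?thesis by simp
  qed
  then show ?thesis
    unfolding evaluate_def by (simp add: sum.If_cases Int_def)
qed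

lemma evaluate_truncate_span:
  "evaluate (\<lambda>j. if j < m then var j else 0) ` (monomial_span U :: 'k::field mpoly set) =
    monomial_span (U \<inter> expos m)"
proof (intro equalityI subsetI)
  fix g :: "'k mpoly"
  assume "g \<in> evaluate (\<lambda>j. if j < m then var j else 0) ` monomial_span U"
  then obtain f :: "'k mpoly" where f: "keys f \<subseteq> U"
    and g: "g = (\<Sum>u\<in>keys f \<inter> expos m. Poly_Mapping.single u (lookup f u))"
    by (auto simp: monomial_span_def evaluate_truncate)
  have "u \<in> keys f \<inter> expos m" if "u \<in> keys g" for u
    using that unfolding g by (auto simp: in_keys_iff lookup_sum lookup_single when_def split: if_splits)
  with f show "g \<in> monomial_span (U \<inter> expos m)" by (auto simp: monomial_span_def)
next
  fix g :: "'k mpoly"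
  assume g: "g \<in> monomial_span (U \<inter> expos m)"
  then have "keys g \<inter> expos m = keys g" by (auto simp: monomial_span_def)
  \<comment> \<open>Truncation is a projection: a polynomial in the first \<open>m\<close> variables
    is its own preimage.\<close>
  then have "evaluate (\<lambda>j. if j < m then var j else 0) g = g"
    by (simp add: evaluate_truncate sum_single_lookup)
  with g show "g \<in> evaluate (\<lambda>j. if j < m then var j else 0) ` monomial_span U"
    by (intro image_eqI[of _ _ g]) (auto simp: monomial_span_def)
qed

text \<open>The sum of single entries matches the exponent that \<open>xpow_prod\<close> produces
  after the factors equal to 1 are removed.\<close>

definition drop_var :: "nat \<Rightarrow> expo \<Rightarrow> expo" where
  "drop_var l u = (\<Sum>j\<in>keys u - {l}. Poly_Mapping.single j (lookup u j))"

lemma lookup_drop_var: "lookup (drop_var l u) j = (if j = l then 0 else lookup u j)"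
  by (auto simp: drop_var_def lookup_sum lookup_single when_def in_keys_iff)

lemma evaluate_drop_var:
  "evaluate (\<lambda>j. if j = l then 1 else var j) (xpow u) = (xpow (drop_var l u) :: 'k::field mpoly)"
proof -
  have "(\<Prod>j\<in>keys u. (if j = l then 1 else var j) ^ lookup u j) =
      (\<Prod>j\<in>keys u - {l}. var j ^ lookup u j :: 'k mpoly)"
    by (rule prod.mono_neutral_cong_right) auto
  then show ?thesis
    by (simp add: evaluate_def xpow_prod drop_var_def)
      (simp add: xpow_def Poly_Mapping.mult_single)
qed

text \<open>Setting the last variable to 1 erases the last coordinate of each generator. An exponent
  dominates such a shortened generator exactly when a large enough last coordinate would make it
  dominate the original one.\<close>

lemma dehomogenized_ideal:
  assumes "m \<ge> 1"
  shows "Idl\<^bsub>mpoly_ring m\<^esub> (evaluate (\<lambda>j. if j = m - 1 then 1 else var j) `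
      (monomials m \<inter> monomial_span (expos m \<inter> upset E))) =
    (monomial_span {u \<in> expos m. \<exists>k. u + Poly_Mapping.single (m - 1) k \<in> upset E} :: 'k::field mpoly set)"
proof -
  let ?A = "drop_var (m - 1) ` (expos m \<inter> upset E)"
  have "(monomials m \<inter> monomial_span (expos m \<inter> upset E) :: 'k mpoly set) =
      xpow ` (expos m \<inter> upset E)"
    by (auto simp: monomials_def)
  then have "evaluate (\<lambda>j. if j = m - 1 then 1 else var j) `
      (monomials m \<inter> monomial_span (expos m \<inter> upset E)) = (xpow ` ?A :: 'k mpoly set)"
    by (simp only: image_image evaluate_drop_var)
  moreover have "?A \<subseteq> expos m" by (auto simp: in_expos_iff lookup_drop_var)
  moreover have "expos m \<inter> upset ?A =
      {u \<in> expos m. \<exists>k. u + Poly_Mapping.single (m - 1) k \<in> upset E}"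
  proof (intro equalityI subsetI)
    fix u assume "u \<in> expos m \<inter> upset ?A"
    then obtain v where u: "u \<in> expos m" and v: "v \<in> upset E"
      and le: "\<And>j. lookup (drop_var (m - 1) v) j \<le> lookup u j"
      by (auto simp: in_upset_iff)
    \<comment> \<open>The witness for \<open>k\<close> is the last coordinate of \<open>v\<close>,
      the only one that \<open>drop_var\<close> has lost.\<close>
    have "lookup v j \<le> lookup (u + Poly_Mapping.single (m - 1) (lookup v (m - 1))) j" for j
      using le[of j] by (auto simp: lookup_add lookup_single when_def lookup_drop_var split: if_splits)
    from upset_mono[OF v this] u
    show "u \<in> {u \<in> expos m. \<exists>k. u + Poly_Mapping.single (m - 1) k \<in> upset E}" by blast
  next
    fix u assume "u \<in> {u \<in> expos m. \<exists>k. u + Poly_Mapping.single (m - 1) k \<in> upset E}"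
    then obtain k where u: "u \<in> expos m" and k: "u + Poly_Mapping.single (m - 1) k \<in> upset E"
      by blast
    \<comment> \<open>Since \<open>m >= 1\<close>, the index \<open>m - 1\<close> is below
      \<open>m\<close>, so the last variable belongs to the ring.\<close>
    have "u + Poly_Mapping.single (m - 1) k \<in> expos m"
      using u assms by (auto simp: in_expos_iff lookup_add lookup_single when_def)
    with k have "drop_var (m - 1) (u + Poly_Mapping.single (m - 1) k) \<in> ?A" by blast
    moreover have "lookup (drop_var (m - 1) (u + Poly_Mapping.single (m - 1) k)) j \<le> lookup u j" for j
      by (auto simp: lookup_drop_var lookup_add lookup_single when_def)
    ultimately have "u \<in> upset ?A" unfolding in_upset_iff[of u] by blast
    with u show "u \<in> expos m \<inter> upset ?A" by blast
  qed
  ultimately show ?thesis by (simp add: Idl_eq_monomial_span)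
qed

section \<open>Minimal generators of the initial ideal\<close>

lemma initial_ideal_generators:
  fixes I :: "'k::field mpoly set"
  assumes I: "ideal I (mpoly_ring n)"
  obtains M where "M \<subseteq> expos n" "initial_ideal n I = monomial_span (expos n \<inter> upset M)"
    "min_monomial_gens n (initial_ideal n I) = xpow ` M"
    "\<And>u. u \<in> M \<Longrightarrow> \<exists>f\<in>I. is_leading_expo f u"
proof -
  define A where "A = {u. \<exists>f\<in>I. is_leading_expo f u}"
  have "I \<subseteq> carrier (mpoly_ring n)"
    by (rule additive_subgroup.a_subset[OF ideal.axioms(1)[OF I]])
  then have A: "A \<subseteq> expos n"
    by (fastforce simp: A_def is_leading_expo_def mpoly_ring_def)
  let ?J = "Idl\<^bsub>mpoly_ring n\<^esub> (xpow ` A) :: 'k mpoly set"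
  have J: "initial_ideal n I = ?J"
    unfolding initial_ideal_def A_def by (rule arg_cong[where f = "genideal _"]) auto
  \<comment> \<open>The divisibility-minimal exponents of the ideal, in the form supplied by
    \<open>is_min_monomial_gens_iff\<close>.\<close>
  define M where "M = {u. xpow u \<in> ?J \<and> (\<forall>w z. u = w + z \<and> xpow w \<in> ?J \<longrightarrow> w = u)}"
  have min: "is_min_monomial_gens n ?J (xpow ` M)"
    using is_min_monomial_gens_iff[OF A, where 'k = 'k] unfolding M_def by blast
  then have gens: "min_monomial_gens n ?J = xpow ` M"
    unfolding min_monomial_gens_def by (rule the1_equality[OF ex1_min_monomial_gens[OF A]])
  have in_J: "(xpow u :: 'k mpoly) \<in> ?J \<longleftrightarrow> u \<in> expos n \<and> u \<in> upset A" for u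
    by (simp add: Idl_eq_monomial_span[OF A])
  have M: "M \<subseteq> expos n" "M \<subseteq> A"
  proof -
    show "M \<subseteq> expos n" unfolding M_def in_J by blast
    \<comment> \<open>A minimal generator is divisible by the monomial of some leading exponent
      \<open>a\<close>, which is itself in the ideal; minimality forces equality. Hence each
      generator is the leading monomial of an actual element of \<open>I\<close>.\<close>
    show "M \<subseteq> A"
    proof
      fix u assume u: "u \<in> M"
      then obtain a w where a: "a \<in> A" "u = a + w" unfolding M_def in_J upset_def by blast
      then have "(xpow a :: 'k mpoly) \<in> ?J" using A by (auto simp: in_J in_upset_iff)
      with u a(2) have "a = u" unfolding M_def by blast
      with a(1) show "u \<in> A" by blast
    qed
  qed
  have "?J = Idl\<^bsub>mpoly_ring n\<^esub> (xpow ` M)"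
    using min unfolding is_min_monomial_gens_def by blast
  then have eq: "?J = monomial_span (expos n \<inter> upset M)"
    by (simp only: Idl_eq_monomial_span[OF M(1)])
  show thesis
  proof (rule that)
    show "M \<subseteq> expos n" by (rule M(1))
    show "initial_ideal n I = monomial_span (expos n \<inter> upset M)" unfolding J by (rule eq)
    show "min_monomial_gens n (initial_ideal n I) = xpow ` M" unfolding J by (rule gens)
    show "\<exists>f\<in>I. is_leading_expo f u" if "u \<in> M" for u using that M(2) by (auto simp: A_def)
  qed
qed

text \<open>The zero exponent is the least one in a degree order, so a polynomial led by it is a
  nonzero constant. An ideal containing this unit is the whole ring.\<close>

lemma zero_not_leading_expo_of_proper:
  fixes I :: "'k::field mpoly set"
  assumes I: "ideal I (mpoly_ring n)" and proper: "I \<noteq> carrier (mpoly_ring n)"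
    and f: "f \<in> I"
  shows "\<not> is_leading_expo f 0"
proof
  assume lead: "is_leading_expo f 0"
  have "\<not> drl_less w 0" for w
  proof -
    have "w = 0" if "deg w = 0"
      using that by (intro poly_mapping_eqI) (auto simp: deg_def in_keys_iff)
    then show ?thesis by (auto simp: drl_less_def deg_def)
  qed
  with lead have key: "keys f = {0}" by (auto simp: is_leading_expo_def)
  define c where "c = lookup f 0"
  have c: "c \<noteq> 0" using key by (auto simp: c_def in_keys_iff)
  have "f = Poly_Mapping.single 0 c"
  proof (rule poly_mapping_eqI)
    show "lookup f u = lookup (Poly_Mapping.single 0 c) u" for u
      using key in_keys_iff[of u f] by (cases "u = 0") (auto simp: c_def lookup_single when_def)
  qed
  then have "Poly_Mapping.single 0 (inverse c) * f = 1"
    using c by (simp add: Poly_Mapping.mult_single)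
  moreover have "Poly_Mapping.single 0 (inverse c) \<in> carrier (mpoly_ring n :: 'k mpoly ring)"
    by (auto simp: mpoly_ring_def expos_def)
  ultimately have "\<one>\<^bsub>mpoly_ring n\<^esub> \<in> I"
    using ideal.I_l_closed[OF I f] by (fastforce simp: mpoly_ring_def)
  with proper ideal.one_imp_carrier[OF I] show False by blast
qed

section \<open>Translating the graded quotient and \<open>c_inv\<close> into exponents\<close>

lemma quot_component_nontrivial_iff:
  assumes N: "ideal (monomial_span N) (mpoly_ring m :: 'k::field mpoly ring)"
    and M: "M \<subseteq> expos m"
  shows "quot_component m (monomial_span M) (monomial_span N) r \<noteq> {monomial_span N :: 'k mpoly set}
    \<longleftrightarrow> (\<exists>u\<in>M - N. deg u = r)" (is "?Q \<noteq> _ \<longleftrightarrow> _")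
proof -
  interpret N: ideal "monomial_span N" "mpoly_ring m :: 'k mpoly ring" by (rule N)
  have coset: "monomial_span N +>\<^bsub>mpoly_ring m\<^esub> f = monomial_span N \<longleftrightarrow> f \<in> monomial_span N"
    if "f \<in> monomial_span M" for f :: "'k mpoly"
  proof
    assume "monomial_span N +>\<^bsub>mpoly_ring m\<^esub> f = monomial_span N"
    moreover have "f \<in> carrier (mpoly_ring m)"
      using that M by (auto simp: monomial_span_def mpoly_ring_def)
    ultimately show "f \<in> monomial_span N"
      using N.a_rcos_self by fastforce
  qed (rule N.a_rcos_const)
  \<comment> \<open>The zero coset is always in the component, represented by 0, so differing from
    the singleton means containing another coset.\<close>
  have "0 \<in> (monomial_span M :: 'k mpoly set)" "0 \<in> (monomial_span N :: 'k mpoly set)"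
      "homogeneous r (0 :: 'k mpoly)"
    by (auto simp: monomial_span_def homogeneous_def)
  with coset have "monomial_span N \<in> ?Q" unfolding quot_component_def by blast
  then have "?Q \<noteq> {monomial_span N} \<longleftrightarrow> (\<exists>C\<in>?Q. C \<noteq> monomial_span N)" by blast
  also have "\<dots> \<longleftrightarrow> (\<exists>f :: 'k mpoly. f \<in> monomial_span M \<and> homogeneous r f \<and>
      monomial_span N +>\<^bsub>mpoly_ring m\<^esub> f \<noteq> monomial_span N)"
    unfolding quot_component_def by blast
  also have "\<dots> \<longleftrightarrow> (\<exists>f :: 'k mpoly. f \<in> monomial_span M - monomial_span N \<and> homogeneous r f)"
    using coset by (intro ex_cong1) (simp cong: conj_cong, blast)
  \<comment> \<open>A monomial serves as \<open>f\<close> in one direction. In the other, an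
    \<open>f\<close> outside the span of \<open>N\<close> has a key outside \<open>N\<close>, and
    homogeneity gives this key degree \<open>r\<close>.\<close>
  also have "\<dots> \<longleftrightarrow> (\<exists>u\<in>M - N. deg u = r)"
  proof
    assume "\<exists>u\<in>M - N. deg u = r"
    then obtain u where "u \<in> M - N" "deg u = r" by blast
    then have "xpow u \<in> monomial_span M - monomial_span N" "homogeneous r (xpow u :: 'k mpoly)"
      by (auto simp: homogeneous_def xpow_def monomial_span_def)
    then show "\<exists>f :: 'k mpoly. f \<in> monomial_span M - monomial_span N \<and> homogeneous r f" by blast
  qed (fastforce simp: monomial_span_def homogeneous_def)
  finally show ?thesis .
qed

lemma c_inv_eq_Sup_gap:
  fixes I :: "'k::field mpoly set"
  assumes I: "ideal I (mpoly_ring n)" and i: "i < n"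
  shows "c_inv n i I = Sup ((\<lambda>u. ereal (real (deg u))) ` gap (n - i) (E_set n i I))"
proof -
  define m where "m = n - i"
  define E where "E = E_set n i I"
  obtain M where M: "M \<subseteq> expos n" "initial_ideal n I = monomial_span (expos n \<inter> upset M)"
      "min_monomial_gens n (initial_ideal n I) = xpow ` M"
    using initial_ideal_generators[OF I] by metis
  have E: "E = expos m \<inter> M"
    by (auto simp: E_def E_set_def M(3) m_def)
  \<comment> \<open>A divisor of a monomial in the first \<open>m\<close> variables uses only these
    variables. Hence, below such a monomial, the generators of the initial ideal can be replaced by
    those in \<open>E\<close>.\<close>
  have below: "a \<in> expos m" if "u \<in> expos m" "\<forall>j. lookup a j \<le> lookup u j" for u a
    using that unfolding in_expos_iff by (metis le_zero_eq)
  have "expos m \<subseteq> expos n" by (auto simp: in_expos_iff m_def)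
  then have "expos n \<inter> upset M \<inter> expos m = expos m \<inter> upset E"
    unfolding E in_upset_iff set_eq_iff Int_iff using below by blast
  then have J: "J_ideal n i I = monomial_span (expos m \<inter> upset E)"
    unfolding J_ideal_def M(2) m_def[symmetric] by (simp add: evaluate_truncate_span)
  let ?T = "{u \<in> expos m. \<exists>k. u + Poly_Mapping.single (m - 1) k \<in> upset E}"
  have Jt: "Jt_ideal n i I = monomial_span ?T"
    unfolding Jt_ideal_def J m_def[symmetric]
    by (rule dehomogenized_ideal) (use i in \<open>simp add: m_def\<close>)
  have "ideal (monomial_span (expos m \<inter> upset E)) (mpoly_ring m :: 'k mpoly ring)"
  proof -
    interpret cring "mpoly_ring m :: 'k mpoly ring" by (rule cring_mpoly_ring)
    have "E \<subseteq> expos m" using E by blast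
    moreover from this have "xpow ` E \<subseteq> carrier (mpoly_ring m :: 'k mpoly ring)"
      by (auto simp: mpoly_ring_def xpow_def)
    ultimately show ?thesis using genideal_ideal[of "xpow ` E"] by (simp add: Idl_eq_monomial_span)
  qed
  from quot_component_nontrivial_iff[OF this, of ?T]
  have "quot_component m (Jt_ideal n i I) (J_ideal n i I) r \<noteq> {J_ideal n i I} \<longleftrightarrow>
      (\<exists>u\<in>gap m E. deg u = r)" for r
    unfolding J Jt gap_def by auto
  then have "c_inv n i I = Sup {ereal (real r) | r. \<exists>u\<in>gap m E. deg u = r}"
    unfolding c_inv_def m_def by simp
  also have "{ereal (real r) | r. \<exists>u\<in>gap m E. deg u = r} = (\<lambda>u. ereal (real (deg u))) ` gap m E"
    by auto
  finally show ?thesis by (simp add: m_def E_def)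
qed

section \<open>Gap exponents versus the vectors in \<open>F_of\<close>, and the resulting
  maximum\<close>

lemma F_of_in_gap:
  assumes E: "E \<subseteq> expos m" and m: "m \<ge> 1" and zero: "0 \<notin> E" and a: "a \<in> F_of m E"
  obtains u where "u \<in> gap m E" "vec_sum m a = int (deg u)"
proof -
  from a obtain v where v: "\<And>j. j < m \<Longrightarrow> v j \<in> E"
    and dom: "\<And>j h. j < m \<Longrightarrow> h < m \<Longrightarrow> h \<noteq> j \<Longrightarrow> lookup (v h) j < lookup (v j) j"
    and a_def: "a = (\<lambda>j. if j < m then int (Max ((\<lambda>h. lookup (v h) j) ` {..<m})) - 1 else 0)"
    and not_ge: "\<And>v. v \<in> E \<Longrightarrow> \<not> (\<forall>j<m. int (lookup v j) \<le> a j)"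
    unfolding F_of_def by blast
  \<comment> \<open>Strict dominance means that the maximum in coordinate \<open>j\<close> is
    attained by \<open>v j\<close>.\<close>
  have a_eq: "a j = int (lookup (v j) j) - 1" if "j < m" for j
  proof -
    have "Max ((\<lambda>h. lookup (v h) j) ` {..<m}) = lookup (v j) j"
    proof (rule Max_eqI)
      fix y assume "y \<in> (\<lambda>h. lookup (v h) j) ` {..<m}"
      then obtain h where "h < m" "y = lookup (v h) j" by blast
      then show "y \<le> lookup (v j) j"
        using dom[OF that, of h] by (cases "h = j") auto
    qed (use that in auto)
    with that show ?thesis by (simp add: a_def)
  qed
  \<comment> \<open>This makes the entries of \<open>a\<close> nonnegative. For \<open>m = 1\<close>
    dominance is vacuous and positivity comes from \<open>0\<close> not being in \<open>E\<close>;
    otherwise a second index provides a smaller natural number.\<close>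
  have pos: "lookup (v j) j > 0" if j: "j < m" for j
  proof (cases "m = 1")
    case True
    with j v have "v j \<in> E" "j = 0" by auto
    moreover from this zero obtain l where "lookup (v j) l \<noteq> 0"
      by (metis poly_mapping_eqI lookup_zero)
    moreover from this have "l < m" using \<open>v j \<in> E\<close> E
      by (meson in_expos_iff leI subsetD)
    ultimately show ?thesis using True by simp
  next
    case False
    with m have "(if j = 0 then 1 else 0) < m" "(if j = 0 then 1 else 0) \<noteq> j" by auto
    from dom[OF j this] show ?thesis by simp
  qed
  \<comment> \<open>The exponent form of \<open>a\<close>; by \<open>pos\<close> the truncated
    subtraction agrees with the integer one.\<close>
  define u where "u = (\<Sum>j<m. Poly_Mapping.single j (lookup (v j) j - 1))"
  have lu: "lookup u j = (if j < m then lookup (v j) j - 1 else 0)" for j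
    by (auto simp: u_def lookup_sum lookup_single when_def)
  have au: "a j = int (lookup u j)" if "j < m" for j
    using that pos[OF that] by (simp add: lu a_eq)
  have ue: "u \<in> expos m" by (simp add: in_expos_iff lu)
  have "u \<notin> upset E"
    using not_ge au by (fastforce simp: in_upset_iff)
  \<comment> \<open>One unit suffices: \<open>v (m - 1)\<close> exceeds \<open>u\<close> by 1 in the
    last coordinate and, by strict dominance, is at most \<open>u\<close> in the others.\<close>
  moreover have "u + Poly_Mapping.single (m - 1) 1 \<in> upset E"
  proof -
    have "lookup (v (m - 1)) j \<le> lookup (u + Poly_Mapping.single (m - 1) 1) j" for j
    proof (cases "j < m")
      case True
      then show ?thesis
        using dom[of j "m - 1"] m pos[of j]
        by (cases "j = m - 1") (auto simp: lookup_add lookup_single when_def lu)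
    next
      case False
      then show ?thesis using v[of "m - 1"] E m by (auto simp: in_expos_iff)
    qed
    then show ?thesis using v[of "m - 1"] m by (auto simp: in_upset_iff)
  qed
  ultimately have "u \<in> gap m E" using ue by (auto simp: gap_def)
  moreover have "vec_sum m a = int (deg u)"
    using au by (simp add: vec_sum_def deg_eq_sum[OF ue])
  ultimately show thesis by (rule that)
qed

lemma maximal_gap_in_F_of:
  assumes E: "E \<subseteq> expos m" and u: "u \<in> gap m E"
    and max: "\<And>w. w \<in> gap m E \<Longrightarrow> deg w \<le> deg u"
  shows "(\<lambda>j. int (lookup u j)) \<in> F_of m E"
proof -
  have ue: "u \<in> expos m" and un: "u \<notin> upset E"
    using u by (auto simp: gap_def)
  obtain k where k: "u + Poly_Mapping.single (m - 1) k \<in> upset E"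
    using u by (auto simp: gap_def)
  let ?w = "\<lambda>j. u + Poly_Mapping.single j 1"
  \<comment> \<open>Raising a coordinate preserves membership in the saturation. If the result
    avoided \<open>upset E\<close>, it would be a gap exponent of degree one higher, against
    maximality.\<close>
  have up: "?w j \<in> upset E" if j: "j < m" for j
  proof (rule ccontr)
    assume "?w j \<notin> upset E"
    moreover have we: "?w j \<in> expos m"
      using ue j by (auto simp: in_expos_iff lookup_add lookup_single when_def)
    moreover have "?w j + Poly_Mapping.single (m - 1) k \<in> upset E"
      using upset_add[OF k, of "Poly_Mapping.single j 1"] by (simp add: ac_simps)
    ultimately have "deg (?w j) \<le> deg u" by (intro max) (auto simp: gap_def)
    moreover have "deg (?w j) = deg u + 1"
      unfolding deg_eq_sum[OF we] deg_eq_sum[OF ue]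
      using j by (simp add: lookup_add sum.distrib lookup_single when_def)
    ultimately show False by simp
  qed
  then obtain v where v: "\<And>j. j < m \<Longrightarrow> v j \<in> E"
    and le: "\<And>j l. j < m \<Longrightarrow> lookup (v j) l \<le> lookup (?w j) l"
    unfolding in_upset_iff by metis
  have off: "lookup (v h) j \<le> lookup u j" if "h < m" "h \<noteq> j" for h j
    using le[OF that(1), of j] that by (simp add: lookup_add lookup_single when_def)
  \<comment> \<open>If \<open>v j\<close> did not exceed \<open>u\<close> in coordinate
    \<open>j\<close>, it would lie below \<open>u\<close> everywhere and put \<open>u\<close> into
    \<open>upset E\<close>. The excess of exactly 1 yields both the strict dominance and, after
    subtracting 1 from the maximum, \<open>u\<close> itself.\<close>
  have diag: "lookup (v j) j = lookup u j + 1" if j: "j < m" for j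
  proof -
    have "lookup (v j) j \<le> lookup u j + 1"
      using le[OF j, of j] by (simp add: lookup_add lookup_single when_def)
    moreover have "\<not> lookup (v j) j \<le> lookup u j"
    proof
      assume "lookup (v j) j \<le> lookup u j"
      then have "lookup (v j) l \<le> lookup u l" for l
        using off[OF j, of l] by (cases "l = j") auto
      with un v[OF j] show False by (auto simp: in_upset_iff)
    qed
    ultimately show ?thesis by simp
  qed
  have Max: "Max ((\<lambda>h. lookup (v h) j) ` {..<m}) = lookup u j + 1" if j: "j < m" for j
  proof (rule Max_eqI)
    fix y assume "y \<in> (\<lambda>h. lookup (v h) j) ` {..<m}"
    then obtain h where "h < m" "y = lookup (v h) j" by blast
    then show "y \<le> lookup u j + 1"
      using off[of h j] diag[OF j] by (cases "h = j") auto
  qed (use diag[OF j] j in \<open>auto intro!: image_eqI[of _ _ j]\<close>)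
  have "(\<lambda>j. int (lookup u j)) =
      (\<lambda>j. if j < m then int (Max ((\<lambda>h. lookup (v h) j) ` {..<m})) - 1 else 0)"
    using Max ue by (auto simp: in_expos_iff fun_eq_iff)
  moreover have "lookup (v h) j < lookup (v j) j" if "j < m" "h < m" "h \<noteq> j" for j h
    using off[of h j] diag[of j] that by simp
  moreover have "\<not> (\<forall>j<m. int (lookup e j) \<le> int (lookup u j))" if "e \<in> E" for e
  proof
    assume le: "\<forall>j<m. int (lookup e j) \<le> int (lookup u j)"
    have "lookup e j \<le> lookup u j" for j
      using le that E by (cases "j < m") (auto simp: in_expos_iff)
    with un that show False by (auto simp: in_upset_iff)
  qed
  ultimately show ?thesis
    unfolding F_of_def mem_Collect_eq using v by blast
qed

theorem proposition4p2:
  fixes I :: "'k::field mpoly set" and n i :: nat and d :: enat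
  assumes "n \<ge> 1"
    and "homogeneous_ideal n I"
    and "I \<noteq> carrier (mpoly_ring n)"
    and "d = krull_dim (mpoly_ring n Quot I)"
    and "enat i \<le> min d (enat (n - 1))"
    and "c_inv n i I < \<infinity>"
  shows "(F_set n i I = {} \<longrightarrow> c_inv n i I = -\<infinity>) \<and>
    (F_set n i I \<noteq> {} \<longrightarrow>
      c_inv n i I = ereal (real_of_int (Max (vec_sum (n - i) ` F_set n i I))))"
proof -
  define m where "m = n - i"
  define E where "E = E_set n i I"
  have I: "ideal I (mpoly_ring n)" using assms(2) by (simp add: homogeneous_ideal_def)
  have "i \<le> n - 1" using assms(5) by simp
  with assms(1) have i: "i < n" by linarith
  then have m: "m \<ge> 1" by (simp add: m_def)
  have E: "E \<subseteq> expos m" by (auto simp: E_def E_set_def m_def)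
  have zero: "0 \<notin> E"
  proof
    assume "0 \<in> E"
    obtain M where M: "min_monomial_gens n (initial_ideal n I) = xpow ` M"
        "\<And>u. u \<in> M \<Longrightarrow> \<exists>f\<in>I. is_leading_expo f u"
      using initial_ideal_generators[OF I] by metis
    from \<open>0 \<in> E\<close> have "0 \<in> M" by (auto simp: E_def E_set_def M(1))
    from M(2)[OF this] zero_not_leading_expo_of_proper[OF I assms(3)] show False by blast
  qed
  have c: "c_inv n i I = Sup ((\<lambda>u. ereal (real (deg u))) ` gap m E)"
    unfolding m_def E_def by (rule c_inv_eq_Sup_gap[OF I i])
  have F: "F_set n i I = F_of m E" by (simp add: F_set_def m_def E_def)
  show ?thesis
  proof (cases "gap m E = {}")
    case True
    \<comment> \<open>The supremum is then over the empty set, so it is the bottom element, minus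
      infinity.\<close>
    then have "F_of m E = {}" using F_of_in_gap[OF E m zero] by blast
    with True c F show ?thesis by (simp add: bot_ereal_def)
  next
    case False
    then obtain u0 where u0: "u0 \<in> gap m E" by blast
    \<comment> \<open>The finiteness assumption on \<open>c_inv\<close> bounds the gap degrees, so a
      gap exponent of maximal degree exists.\<close>
    obtain b :: nat where b: "c_inv n i I < ereal (real b)"
      using assms(6) less_PInf_Ex_of_nat by auto
    have "deg u < b" if "u \<in> gap m E" for u
    proof -
      have "ereal (real (deg u)) \<le> c_inv n i I"
        unfolding c using that by (rule SUP_upper)
      from this b have "ereal (real (deg u)) < ereal (real b)" by (rule le_less_trans)
      then show ?thesis by simp
    qed
    then have "\<exists>u. u \<in> gap m E \<and> (\<forall>w. w \<in> gap m E \<longrightarrow> deg w \<le> deg u)"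
      using u0 by (intro ex_has_greatest_nat[where k = u0 and b = b]) auto
    then obtain u where u: "u \<in> gap m E" and max: "\<And>w. w \<in> gap m E \<Longrightarrow> deg w \<le> deg u"
      by auto
    define a where "a = (\<lambda>j. int (lookup u j))"
    have a: "a \<in> F_of m E" unfolding a_def by (rule maximal_gap_in_F_of[OF E u max])
    have "u \<in> expos m" using u by (simp add: gap_def)
    then have sum_a: "vec_sum m a = int (deg u)"
      by (simp add: vec_sum_def a_def deg_eq_sum)
    \<comment> \<open>Every coordinate sum over \<open>F_of\<close> is the degree of a gap exponent,
      hence one of finitely many values; this gives the finiteness that \<open>Max\<close>
      requires.\<close>
    have range: "x \<in> int ` {..deg u}" if x: "x \<in> vec_sum m ` F_of m E" for x
    proof -
      obtain a' where "a' \<in> F_of m E" "x = vec_sum m a'" using x by blast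
      then obtain w where "w \<in> gap m E" "x = int (deg w)"
        using F_of_in_gap[OF E m zero] by metis
      with max show ?thesis by blast
    qed
    then have "finite (vec_sum m ` F_of m E)"
      by (meson finite_atMost finite_imageI finite_subset subsetI)
    then have "Max (vec_sum m ` F_of m E) = int (deg u)"
      by (rule Max_eqI) (use range a sum_a in force)+
    moreover have "c_inv n i I = ereal (real (deg u))"
      unfolding c by (rule Sup_eqI) (use u max in auto)
    ultimately show ?thesis using a by (auto simp: F m_def)
  qed
qed

end
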